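(* Let $G$ be a finite undirected graph (multiple edges and loops allowed) and $a\in\mathrm{Iisg}(G)$. Let $\langle a\rangle$ be the set of all $\varphi\in\mathrm{Iisg}(G)$, $\varphi:H\to K$, such that $H$ and $K$ are induced subgraphs of $G$ isomorphic to an induced subgraph of the domain of $a$. Then $\langle a\rangle$ is an ideal of $\mathrm{Iisg}(G)$, and it is the minimal ideal of $\mathrm{Iisg}(G)$ containing $a$.
   Context: Graphs are finite and undirected and may have multiple edges and loops; the empty graph $\emptyset$ counts as a graph and the empty map $\mu_0:\emptyset\to\emptyset$ counts as a graph isomorphism. "Induced subgraph" means vertex induced subgraph. For a graph $G$, $\mathrm{Iisg}(G)$ is the set of all graph isomorphisms $\varphi:H\to J$ (bijections on vertices and on edges preserving incidence) where $H$ and $J$ are induced subgraphs of $G$. For $\varphi,\psi\in\mathrm{Iisg}(G)$ the product $\psi\circ\varphi$ is the composition of partial maps, with domain $\varphi^{-1}(\mathrm{Im}(\varphi)\cap\mathrm{Dom}(\psi))$ and image $\psi(\mathrm{Im}(\varphi)\cap\mathrm{Dom}(\psi))$. With this product $\mathrm{Iisg}(G)$ is an inverse semigroup. An ideal of a semigroup $S$ is a subset $I\subseteq S$ with $SI\subseteq I$ and $IS\subseteq I$. *)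

theory Defs
  imports Main "HOL-Library.Uprod"
begin

text \<open>The end points of an edge form an unordered pair, so loops (\<open>Upair v v\<close>) and multiple
  edges are possible. The values of \<open>ends\<close> outside \<open>edges\<close> are irrelevant.\<close>

record ('v, 'e) multigraph =
  verts :: "'v set"
  edges :: "'e set"
  ends :: "'e \<Rightarrow> 'v uprod"

locale finite_multigraph =
  fixes G :: "('v, 'e) multigraph"
  assumes finite_verts: "finite (verts G)"
    and finite_edges: "finite (edges G)"
    and ends_in_verts: "e \<in> edges G \<Longrightarrow> set_uprod (ends G e) \<subseteq> verts G"

definition incident :: "('v, 'e) multigraph \<Rightarrow> 'v \<Rightarrow> 'e \<Rightarrow> bool" where
  "incident G v e \<longleftrightarrow> v \<in> set_uprod (ends G e)"

text \<open>Since \<open>ends\<close> is inherited unchanged, equality of induced subgraphs of a fixed graph amounts to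
  equality of their vertex and edge sets.\<close>

definition induced_subgraph :: "('v, 'e) multigraph \<Rightarrow> 'v set \<Rightarrow> ('v, 'e) multigraph" where
  "induced_subgraph G W =
     \<lparr>verts = W, edges = {e \<in> edges G. set_uprod (ends G e) \<subseteq> W}, ends = ends G\<rparr>"

definition is_induced_subgraph :: "('v, 'e) multigraph \<Rightarrow> ('v, 'e) multigraph \<Rightarrow> bool" where
  "is_induced_subgraph H G \<longleftrightarrow> (\<exists>W \<subseteq> verts G. H = induced_subgraph G W)"

text \<open>A map \<open>H \<rightarrow> J\<close> between subgraphs is a pair of partial functions on the ambient vertex and edge
  types, whose domains are exactly the vertices and edges of \<open>H\<close>. Two such maps are thus
  equal iff they have the same domain and agree there.\<close>

record ('v, 'e) partial_map =
  vmap :: "'v \<rightharpoonup> 'v"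
  emap :: "'e \<rightharpoonup> 'e"

definition graph_iso ::
  "('v, 'e) multigraph \<Rightarrow> ('v, 'e) multigraph \<Rightarrow> ('v, 'e) partial_map \<Rightarrow> bool" where
  "graph_iso H J \<phi> \<longleftrightarrow>
     dom (vmap \<phi>) = verts H \<and> dom (emap \<phi>) = edges H \<and>
     bij_betw (\<lambda>v. the (vmap \<phi> v)) (verts H) (verts J) \<and>
     bij_betw (\<lambda>e. the (emap \<phi> e)) (edges H) (edges J) \<and>
     (\<forall>v \<in> verts H. \<forall>e \<in> edges H.
        incident H v e \<longleftrightarrow> incident J (the (vmap \<phi> v)) (the (emap \<phi> e)))"

definition isomorphic :: "('v, 'e) multigraph \<Rightarrow> ('v, 'e) multigraph \<Rightarrow> bool" where
  "isomorphic H J \<longleftrightarrow> (\<exists>\<phi>. graph_iso H J \<phi>)"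

definition Iisg :: "('v, 'e) multigraph \<Rightarrow> ('v, 'e) partial_map set" where
  "Iisg G = {\<phi>. \<exists>H J. is_induced_subgraph H G \<and> is_induced_subgraph J G \<and> graph_iso H J \<phi>}"

text \<open>Library composition \<open>g \<circ>\<^sub>m f\<close> of partial functions is defined at \<open>x\<close> iff \<open>f x\<close> is defined and
  lies in \<open>dom g\<close>, i.e. on the preimage under \<open>f\<close> of \<open>ran f \<inter> dom g\<close>.\<close>

definition pcomp ::
  "('v, 'e) partial_map \<Rightarrow> ('v, 'e) partial_map \<Rightarrow> ('v, 'e) partial_map" where
  "pcomp \<psi> \<phi> = \<lparr>vmap = vmap \<psi> \<circ>\<^sub>m vmap \<phi>, emap = emap \<psi> \<circ>\<^sub>m emap \<phi>\<rparr>"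

definition dom_graph :: "('v, 'e) multigraph \<Rightarrow> ('v, 'e) partial_map \<Rightarrow> ('v, 'e) multigraph" where
  "dom_graph G \<phi> = \<lparr>verts = dom (vmap \<phi>), edges = dom (emap \<phi>), ends = ends G\<rparr>"

definition semigroup_ideal :: "'s set \<Rightarrow> ('s \<Rightarrow> 's \<Rightarrow> 's) \<Rightarrow> 's set \<Rightarrow> bool" where
  "semigroup_ideal S mult I \<longleftrightarrow>
     I \<subseteq> S \<and> (\<forall>s \<in> S. \<forall>x \<in> I. mult s x \<in> I) \<and> (\<forall>x \<in> I. \<forall>s \<in> S. mult x s \<in> I)"

definition gen_set ::
  "('v, 'e) multigraph \<Rightarrow> ('v, 'e) partial_map \<Rightarrow> ('v, 'e) partial_map set" where
  "gen_set G a =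
     {\<phi> \<in> Iisg G. \<exists>H K. is_induced_subgraph H G \<and> is_induced_subgraph K G \<and> graph_iso H K \<phi> \<and>
        (\<exists>L. is_induced_subgraph L (dom_graph G a) \<and> isomorphic H L) \<and>
        (\<exists>L. is_induced_subgraph L (dom_graph G a) \<and> isomorphic K L)}"

end

theory Submission
  imports Defs
begin

text \<open>Embeddability of an induced subgraph into the domain of \<open>a\<close> passes to smaller induced subgraphs
  and across isomorphisms. The domain of a product \<open>\<psi> \<circ> \<phi>\<close> is an induced subgraph of the domain of
  \<open>\<phi>\<close> and is isomorphic to an induced subgraph of the image of \<open>\<psi>\<close>; this gives the ideal property.
  For minimality, let \<open>\<phi> : H \<rightarrow> K\<close> and let \<open>\<beta>\<close> be an isomorphism from \<open>H\<close> onto an induced subgraph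
  of the domain of \<open>a\<close>. Then \<open>\<phi> = (\<phi> \<circ> \<beta>\<inverse> \<circ> a\<inverse>) \<circ> (a \<circ> \<beta>)\<close>, so every ideal containing \<open>a\<close>
  contains \<open>\<phi>\<close>.\<close>

section \<open>Inverses and products of injective partial functions\<close>

definition map_inverse :: "('a \<rightharpoonup> 'b) \<Rightarrow> 'b \<rightharpoonup> 'a" where
  "map_inverse f y = (if y \<in> ran f then Some (THE x. f x = Some y) else None)"

text \<open>Injectivity makes the preimage unique, so the definite description finds it. Later
  arguments use the inverse only through this converse relation and its domain and range.\<close>

lemma map_inverse_eq_Some_iff:
  assumes "inj_on f (dom f)"
  shows "map_inverse f y = Some x \<longleftrightarrow> f x = Some y"
proof -
  have unique: "x' = x''" if "f x' = Some y" "f x'' = Some y" for x' x''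
    using that assms by (metis domI inj_onD)
  then have "(THE x. f x = Some y) = x'" if "f x' = Some y" for x'
    using that by blast
  then show ?thesis
    using unique by (auto simp: map_inverse_def ran_def)
qed

lemma dom_map_inverse: "dom (map_inverse f) = ran f"
  by (auto simp: map_inverse_def dom_def)

lemma ran_map_inverse: "inj_on f (dom f) \<Longrightarrow> ran (map_inverse f) = dom f"
  by (auto simp: ran_def map_inverse_eq_Some_iff)

lemma inj_on_map_inverse:
  assumes "inj_on f (dom f)"
  shows "inj_on (map_inverse f) (ran f)"
proof (rule inj_onI)
  fix y z assume "y \<in> ran f" and eq: "map_inverse f y = map_inverse f z"
  then obtain x where "f x = Some y"
    by (auto simp: ran_def)
  moreover from this have "f x = Some z"
    using assms eq by (metis map_inverse_eq_Some_iff)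
  ultimately show "y = z"
    by simp
qed

lemma inj_on_map_comp:
  assumes f: "inj_on f (dom f)" and g: "inj_on g (dom g)"
  shows "inj_on (g \<circ>\<^sub>m f) (dom (g \<circ>\<^sub>m f))"
proof (rule inj_onI)
  fix x y assume "x \<in> dom (g \<circ>\<^sub>m f)" and eq: "(g \<circ>\<^sub>m f) x = (g \<circ>\<^sub>m f) y"
  then obtain z where "(g \<circ>\<^sub>m f) x = Some z" "(g \<circ>\<^sub>m f) y = Some z"
    by (metis domD)
  then obtain u v where "f x = Some u" "f y = Some v" "g u = Some z" "g v = Some z"
    by (auto simp: map_comp_Some_iff)
  then show "x = y"
    using f g by (metis domI inj_onD)
qed

section \<open>Graph isomorphisms as pairs of injective partial functions\<close>

lemma bij_betw_the_iff:
  assumes "dom f = A"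
  shows "bij_betw (\<lambda>x. the (f x)) A B \<longleftrightarrow> inj_on f (dom f) \<and> ran f = B"
proof -
  have "(\<lambda>x. the (f x)) ` A = ran f"
    using assms by (force simp: ran_def image_iff)
  \<comment> \<open>On the domain no value is \<open>None\<close>, and there \<open>the\<close> is
    injective.\<close>
  moreover have "inj_on (\<lambda>x. the (f x)) A \<longleftrightarrow> inj_on f (dom f)"
    using assms unfolding inj_on_def by (metis domIff option.expand)
  ultimately show ?thesis
    by (auto simp: bij_betw_def)
qed

text \<open>The relational form is symmetric in source and target, so it passes to inverses and
  products by rewriting. \<open>ends G\<close> serves both sides because induced subgraphs inherit
  it.\<close>

definition map_preserves_incidence ::
  "('v, 'e) multigraph \<Rightarrow> ('v, 'e) partial_map \<Rightarrow> bool" where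
  "map_preserves_incidence G \<phi> \<longleftrightarrow>
     (\<forall>v x e d. vmap \<phi> v = Some x \<and> emap \<phi> e = Some d \<longrightarrow>
        (v \<in> set_uprod (ends G e) \<longleftrightarrow> x \<in> set_uprod (ends G d)))"

abbreviation induced_edges :: "('v, 'e) multigraph \<Rightarrow> 'v set \<Rightarrow> 'e set" where
  "induced_edges G W \<equiv> {e \<in> edges G. set_uprod (ends G e) \<subseteq> W}"

abbreviation induced_iso ::
  "('v, 'e) multigraph \<Rightarrow> 'v set \<Rightarrow> 'v set \<Rightarrow> ('v, 'e) partial_map \<Rightarrow> bool" where
  "induced_iso G W U \<equiv> graph_iso (induced_subgraph G W) (induced_subgraph G U)"

text \<open>This trades bijectivity of the total functions built with \<open>the\<close> for
  conditions on domain, range and injectivity. Inversion then merely swaps domains and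
  ranges.\<close>

lemma induced_iso_iff:
  "induced_iso G W U \<phi> \<longleftrightarrow>
     dom (vmap \<phi>) = W \<and> ran (vmap \<phi>) = U \<and> inj_on (vmap \<phi>) (dom (vmap \<phi>)) \<and>
     dom (emap \<phi>) = induced_edges G W \<and> ran (emap \<phi>) = induced_edges G U \<and>
     inj_on (emap \<phi>) (dom (emap \<phi>)) \<and> map_preserves_incidence G \<phi>"
    (is "?L \<longleftrightarrow> _")
\<comment> \<open>Both sides contain the two domain equations, so only the case where these hold has
  content.\<close>
proof (cases "dom (vmap \<phi>) = W \<and> dom (emap \<phi>) = induced_edges G W")
  case True
  then have doms: "dom (vmap \<phi>) = W" "dom (emap \<phi>) = induced_edges G W"
    by blast+
  let ?inc = "\<forall>v\<in>dom (vmap \<phi>). \<forall>e\<in>dom (emap \<phi>). v \<in> set_uprod (ends G e) \<longleftrightarrow>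
      the (vmap \<phi> v) \<in> set_uprod (ends G (the (emap \<phi> e)))"
  have "?inc \<longleftrightarrow> map_preserves_incidence G \<phi>"
  proof
    assume inc: ?inc
    show "map_preserves_incidence G \<phi>"
      unfolding map_preserves_incidence_def
    proof (intro allI impI)
      fix v x e d assume "vmap \<phi> v = Some x \<and> emap \<phi> e = Some d"
      then show "v \<in> set_uprod (ends G e) \<longleftrightarrow> x \<in> set_uprod (ends G d)"
        using inc[rule_format, of v e] by (simp add: domI)
    qed
  next
    assume "map_preserves_incidence G \<phi>"
    then show ?inc
      by (auto simp: map_preserves_incidence_def)
  qed
  moreover have "?L \<longleftrightarrow> bij_betw (\<lambda>v. the (vmap \<phi> v)) W U \<and>
      bij_betw (\<lambda>e. the (emap \<phi> e)) (induced_edges G W) (induced_edges G U) \<and> ?inc"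
    unfolding doms by (simp add: graph_iso_def induced_subgraph_def incident_def doms)
  ultimately show ?thesis
    unfolding bij_betw_the_iff[OF doms(1)] bij_betw_the_iff[OF doms(2)]
    using doms by blast
next
  case False
  then show ?thesis
    by (auto simp: graph_iso_def induced_subgraph_def)
qed

section \<open>Inverses and products of isomorphisms between induced subgraphs\<close>

definition partial_map_inverse :: "('v, 'e) partial_map \<Rightarrow> ('v, 'e) partial_map" where
  "partial_map_inverse \<phi> = \<lparr>vmap = map_inverse (vmap \<phi>), emap = map_inverse (emap \<phi>)\<rparr>"

lemma induced_iso_inverse:
  assumes "induced_iso G W U \<phi>"
  shows "induced_iso G U W (partial_map_inverse \<phi>)"
proof -
  have inj: "inj_on (vmap \<phi>) (dom (vmap \<phi>))" "inj_on (emap \<phi>) (dom (emap \<phi>))"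
    using assms unfolding induced_iso_iff by blast+
  have "map_preserves_incidence G (partial_map_inverse \<phi>)"
    using assms unfolding induced_iso_iff map_preserves_incidence_def partial_map_inverse_def
    by (simp add: map_inverse_eq_Some_iff[OF inj(1)] map_inverse_eq_Some_iff[OF inj(2)])
  then show ?thesis
    using assms inj[THEN inj_on_map_inverse] inj[THEN ran_map_inverse]
    unfolding induced_iso_iff by (simp add: partial_map_inverse_def dom_map_inverse)
qed

text \<open>This is why a product again has an induced subgraph as its domain. Ends of an edge go to
  ends of its image, and every end of the image arises in this way, so the ends of \<open>e\<close>
  survive both maps exactly when \<open>e\<close> does.\<close>

lemma dom_emap_comp:
  assumes \<phi>: "induced_iso G W U \<phi>" and \<psi>: "induced_iso G W' U' \<psi>"
  shows "dom (emap \<psi> \<circ>\<^sub>m emap \<phi>) = induced_edges G (dom (vmap \<psi> \<circ>\<^sub>m vmap \<phi>))"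
proof (intro equalityI subsetI)
  fix e assume "e \<in> dom (emap \<psi> \<circ>\<^sub>m emap \<phi>)"
  then obtain d c where dc: "emap \<phi> e = Some d" "emap \<psi> d = Some c"
    by (auto simp: map_comp_Some_iff)
  then have e: "e \<in> edges G" "set_uprod (ends G e) \<subseteq> W" and d: "set_uprod (ends G d) \<subseteq> W'"
    using \<phi> \<psi> unfolding induced_iso_iff by blast+
  have "v \<in> dom (vmap \<psi> \<circ>\<^sub>m vmap \<phi>)" if v: "v \<in> set_uprod (ends G e)" for v
  proof -
    obtain x where x: "vmap \<phi> v = Some x"
      using v e \<phi> unfolding induced_iso_iff by blast
    then have "x \<in> set_uprod (ends G d)"
      using dc v \<phi> unfolding induced_iso_iff map_preserves_incidence_def by blast
    then have "x \<in> dom (vmap \<psi>)"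
      using d \<psi> unfolding induced_iso_iff by blast
    then show ?thesis
      using x by (auto simp: map_comp_Some_iff)
  qed
  then show "e \<in> induced_edges G (dom (vmap \<psi> \<circ>\<^sub>m vmap \<phi>))"
    using e by blast
next
  fix e assume e: "e \<in> induced_edges G (dom (vmap \<psi> \<circ>\<^sub>m vmap \<phi>))"
  moreover have "dom (vmap \<psi> \<circ>\<^sub>m vmap \<phi>) \<subseteq> dom (vmap \<phi>)"
    by (auto simp: map_comp_Some_iff)
  ultimately have "e \<in> dom (emap \<phi>)"
    using \<phi> unfolding induced_iso_iff by blast
  then obtain d where d: "emap \<phi> e = Some d"
    by blast
  then have dU: "d \<in> edges G" "set_uprod (ends G d) \<subseteq> ran (vmap \<phi>)"
    using \<phi> ranI[of "emap \<phi>" e d] unfolding induced_iso_iff by auto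
  \<comment> \<open>Here incidence is reflected: an end of \<open>d\<close> pulls back to an end of
    \<open>e\<close>, where the composite is defined by assumption. As the domain of
    \<open>\<psi>\<close> is induced, it then contains \<open>d\<close>.\<close>
  have "x \<in> W'" if x: "x \<in> set_uprod (ends G d)" for x
  proof -
    obtain v where v: "vmap \<phi> v = Some x"
      using x dU by (auto simp: ran_def)
    then have "v \<in> set_uprod (ends G e)"
      using d x \<phi> unfolding induced_iso_iff map_preserves_incidence_def by blast
    then have "v \<in> dom (vmap \<psi> \<circ>\<^sub>m vmap \<phi>)"
      using e by blast
    then show ?thesis
      using v \<psi> unfolding induced_iso_iff by (auto simp: map_comp_Some_iff)
  qed
  then have "d \<in> dom (emap \<psi>)"
    using dU \<psi> unfolding induced_iso_iff by blast
  then show "e \<in> dom (emap \<psi> \<circ>\<^sub>m emap \<phi>)"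
    using d by (auto simp: map_comp_Some_iff)
qed

text \<open>The inverse of a product is the product of the inverses in reverse order; statements
  about images thus become statements about domains.\<close>

lemma ran_map_comp_eq_dom:
  assumes "inj_on f (dom f)" "inj_on g (dom g)"
  shows "ran (g \<circ>\<^sub>m f) = dom (map_inverse f \<circ>\<^sub>m map_inverse g)"
  using assms by (auto simp: ran_def dom_def map_comp_Some_iff map_inverse_eq_Some_iff)

lemma induced_iso_pcomp:
  assumes \<phi>: "induced_iso G W U \<phi>" and \<psi>: "induced_iso G W' U' \<psi>"
  shows "induced_iso G (dom (vmap \<psi> \<circ>\<^sub>m vmap \<phi>)) (ran (vmap \<psi> \<circ>\<^sub>m vmap \<phi>)) (pcomp \<psi> \<phi>)"
proof -
  have inj: "inj_on (vmap \<phi>) (dom (vmap \<phi>))" "inj_on (vmap \<psi>) (dom (vmap \<psi>))"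
    "inj_on (emap \<phi>) (dom (emap \<phi>))" "inj_on (emap \<psi>) (dom (emap \<psi>))"
    using \<phi> \<psi> unfolding induced_iso_iff by blast+
  \<comment> \<open>The image is induced because it is the domain of the reversed product of the
    inverses.\<close>
  have "ran (emap \<psi> \<circ>\<^sub>m emap \<phi>) = induced_edges G (ran (vmap \<psi> \<circ>\<^sub>m vmap \<phi>))"
    using dom_emap_comp[OF induced_iso_inverse[OF \<psi>] induced_iso_inverse[OF \<phi>]]
    by (simp add: inj ran_map_comp_eq_dom partial_map_inverse_def)
  moreover have "map_preserves_incidence G (pcomp \<psi> \<phi>)"
    using \<phi> \<psi> unfolding induced_iso_iff map_preserves_incidence_def pcomp_def
    by (simp add: map_comp_Some_iff) blast
  ultimately show ?thesis
    unfolding induced_iso_iff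
    using dom_emap_comp[OF \<phi> \<psi>] inj_on_map_comp[OF inj(1,2)] inj_on_map_comp[OF inj(3,4)]
    by (simp add: pcomp_def)
qed

lemma induced_iso_trans:
  assumes \<phi>: "induced_iso G W U \<phi>" and \<psi>: "induced_iso G U X \<psi>"
  shows "induced_iso G W X (pcomp \<psi> \<phi>)"
proof -
  have "ran (vmap \<phi>) = dom (vmap \<psi>)" "dom (vmap \<phi>) = W" "ran (vmap \<psi>) = X"
    using \<phi> \<psi> unfolding induced_iso_iff by blast+
  then have "dom (vmap \<psi> \<circ>\<^sub>m vmap \<phi>) = W" "ran (vmap \<psi> \<circ>\<^sub>m vmap \<phi>) = X"
    by (force simp: map_comp_Some_iff ran_def dom_def set_eq_iff)+
  then show ?thesis
    using induced_iso_pcomp[OF assms] by simp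
qed

section \<open>Identity maps and embeddability\<close>

lemma ran_restrict_Some: "ran (Some |` A) = A"
  by (auto simp: restrict_map_def ran_def split: if_splits)

lemma inj_on_restrict_Some: "inj_on (Some |` A) A"
  by (auto simp: restrict_map_def inj_on_def)

text \<open>Precomposing with such an identity restricts an isomorphism to a smaller induced
  subgraph.\<close>

lemma induced_iso_restrict_id:
  "induced_iso G W W \<lparr>vmap = Some |` W, emap = Some |` induced_edges G W\<rparr>"
proof -
  have "map_preserves_incidence G \<lparr>vmap = Some |` W, emap = Some |` induced_edges G W\<rparr>"
    by (auto simp: map_preserves_incidence_def restrict_map_def split: if_splits)
  then show ?thesis
    unfolding induced_iso_iff by (simp add: ran_restrict_Some inj_on_restrict_Some)
qed

text \<open>Induced subgraphs of \<open>G\<close> are determined by their vertex sets, so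
  embeddability is a relation between vertex sets. \<open>A\<close> will be the vertex set of the
  domain of \<open>a\<close>.\<close>

definition embeds_in :: "('v, 'e) multigraph \<Rightarrow> 'v set \<Rightarrow> 'v set \<Rightarrow> bool" where
  "embeds_in G A W \<longleftrightarrow> (\<exists>L \<subseteq> A. \<exists>\<beta>. induced_iso G W L \<beta>)"

text \<open>Restrict the embedding \<open>\<beta>\<close> to \<open>X\<close> by precomposing with
  the identity on \<open>X\<close>. The product is an isomorphism onto an induced subgraph, and its
  range stays inside \<open>L\<close>.\<close>

lemma embeds_in_subset:
  assumes "embeds_in G A W" "X \<subseteq> W"
  shows "embeds_in G A X"
proof -
  obtain L \<beta> where L: "L \<subseteq> A" and \<beta>: "induced_iso G W L \<beta>"
    using assms by (auto simp: embeds_in_def)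
  have "dom (vmap \<beta>) = W" "ran (vmap \<beta>) = L"
    using \<beta> unfolding induced_iso_iff by blast+
  moreover have "vmap \<beta> \<circ>\<^sub>m (Some |` X) = vmap \<beta> |` X"
    by (auto simp: map_comp_def restrict_map_def)
  moreover have "ran (vmap \<beta> |` X) \<subseteq> ran (vmap \<beta>)"
    by (auto simp: ran_def restrict_map_def)
  ultimately have "dom (vmap \<beta> \<circ>\<^sub>m (Some |` X)) = X" "ran (vmap \<beta> \<circ>\<^sub>m (Some |` X)) \<subseteq> A"
    using L assms(2) by auto
  then show ?thesis
    using induced_iso_pcomp[OF induced_iso_restrict_id[of G X] \<beta>]
    unfolding embeds_in_def by auto
qed

lemma embeds_in_induced_iso:
  assumes "induced_iso G X W \<phi>" "embeds_in G A W"
  shows "embeds_in G A X"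
proof -
  obtain L \<beta> where "L \<subseteq> A" and \<beta>: "induced_iso G W L \<beta>"
    using assms(2) by (auto simp: embeds_in_def)
  then show ?thesis
    using induced_iso_trans[OF assms(1) \<beta>] unfolding embeds_in_def by (intro exI conjI)
qed

section \<open>Membership in \<open>Iisg\<close> and closure under products and inverses\<close>

lemma induced_iso_domD:
  assumes "induced_iso G W U \<phi>"
  shows "dom (vmap \<phi>) = W" "ran (vmap \<phi>) = U"
  using assms by (simp_all add: induced_iso_iff)

text \<open>A partial map determines its own source and target, which removes the existential
  quantifiers.\<close>

lemma Iisg_iff:
  "\<phi> \<in> Iisg G \<longleftrightarrow> dom (vmap \<phi>) \<subseteq> verts G \<and> ran (vmap \<phi>) \<subseteq> verts G \<and>
     induced_iso G (dom (vmap \<phi>)) (ran (vmap \<phi>)) \<phi>"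
proof
  assume "\<phi> \<in> Iisg G"
  then obtain W U where "W \<subseteq> verts G" "U \<subseteq> verts G" "induced_iso G W U \<phi>"
    by (auto simp: Iisg_def is_induced_subgraph_def)
  then show "dom (vmap \<phi>) \<subseteq> verts G \<and> ran (vmap \<phi>) \<subseteq> verts G \<and>
      induced_iso G (dom (vmap \<phi>)) (ran (vmap \<phi>)) \<phi>"
    by (simp add: induced_iso_domD)
qed (auto simp: Iisg_def is_induced_subgraph_def)

lemma Iisg_induced_iso: "\<phi> \<in> Iisg G \<Longrightarrow> induced_iso G (dom (vmap \<phi>)) (ran (vmap \<phi>)) \<phi>"
  by (simp add: Iisg_iff)

lemma pcomp_in_Iisg:
  assumes "\<psi> \<in> Iisg G" "\<phi> \<in> Iisg G"
  shows "pcomp \<psi> \<phi> \<in> Iisg G"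
proof -
  have "dom (vmap (pcomp \<psi> \<phi>)) \<subseteq> dom (vmap \<phi>)" "ran (vmap (pcomp \<psi> \<phi>)) \<subseteq> ran (vmap \<psi>)"
    by (auto simp: pcomp_def map_comp_Some_iff ran_def)
  moreover have "induced_iso G (dom (vmap (pcomp \<psi> \<phi>))) (ran (vmap (pcomp \<psi> \<phi>))) (pcomp \<psi> \<phi>)"
    using induced_iso_pcomp[OF Iisg_induced_iso[OF assms(2)] Iisg_induced_iso[OF assms(1)]]
    by (simp add: pcomp_def)
  ultimately show ?thesis
    using assms unfolding Iisg_iff by blast
qed

lemma partial_map_inverse_in_Iisg:
  assumes "\<phi> \<in> Iisg G"
  shows "partial_map_inverse \<phi> \<in> Iisg G"
proof -
  have "induced_iso G (ran (vmap \<phi>)) (dom (vmap \<phi>)) (partial_map_inverse \<phi>)"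
    by (rule induced_iso_inverse[OF Iisg_induced_iso[OF assms]])
  then show ?thesis
    using assms by (simp add: Iisg_iff induced_iso_domD)
qed

section \<open>The set \<open>gen_set G a\<close> in terms of embeddability\<close>

lemma is_induced_subgraph_dom_graph_iff:
  assumes "a \<in> Iisg G"
  shows "is_induced_subgraph L (dom_graph G a) \<longleftrightarrow>
    (\<exists>X \<subseteq> dom (vmap a). L = induced_subgraph G X)"
proof -
  have "dom (emap a) = induced_edges G (dom (vmap a))"
    using assms by (simp add: Iisg_iff induced_iso_iff)
  \<comment> \<open>As the domain of \<open>a\<close> is induced, every edge of \<open>G\<close>
    with all ends in \<open>X\<close> already lies in \<open>dom (emap a)\<close>.\<close>
  then have "induced_subgraph (dom_graph G a) X = induced_subgraph G X" if "X \<subseteq> dom (vmap a)" for X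
    using that by (auto simp: induced_subgraph_def dom_graph_def)
  then show ?thesis
    unfolding is_induced_subgraph_def by (auto simp: dom_graph_def)
qed

lemma ex_isomorphic_dom_graph_iff:
  assumes "a \<in> Iisg G"
  shows "(\<exists>L. is_induced_subgraph L (dom_graph G a) \<and> isomorphic (induced_subgraph G W) L) \<longleftrightarrow>
    embeds_in G (dom (vmap a)) W"
  unfolding is_induced_subgraph_dom_graph_iff[OF assms] isomorphic_def embeds_in_def by auto

text \<open>The inverse of \<open>\<phi>\<close> carries its range isomorphically onto its domain,
  so an embedding of the domain yields one of the range.\<close>

lemma gen_set_iff:
  assumes "a \<in> Iisg G"
  shows "\<phi> \<in> gen_set G a \<longleftrightarrow> \<phi> \<in> Iisg G \<and> embeds_in G (dom (vmap a)) (dom (vmap \<phi>))"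
proof
  assume L: "\<phi> \<in> gen_set G a"
  then obtain W U where "induced_iso G W U \<phi>" "embeds_in G (dom (vmap a)) W"
    unfolding gen_set_def is_induced_subgraph_def[of _ G]
    using ex_isomorphic_dom_graph_iff[OF assms] by auto
  then show "\<phi> \<in> Iisg G \<and> embeds_in G (dom (vmap a)) (dom (vmap \<phi>))"
    using L by (simp add: gen_set_def induced_iso_domD)
next
  assume R: "\<phi> \<in> Iisg G \<and> embeds_in G (dom (vmap a)) (dom (vmap \<phi>))"
  let ?H = "induced_subgraph G (dom (vmap \<phi>))" and ?K = "induced_subgraph G (ran (vmap \<phi>))"
  have iso: "graph_iso ?H ?K \<phi>" and "is_induced_subgraph ?H G" "is_induced_subgraph ?K G"
    using R by (auto simp: Iisg_iff is_induced_subgraph_def)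
  moreover have "embeds_in G (dom (vmap a)) (ran (vmap \<phi>))"
    using R embeds_in_induced_iso[OF induced_iso_inverse[OF iso]] by blast
  ultimately show "\<phi> \<in> gen_set G a"
    using R ex_isomorphic_dom_graph_iff[OF assms] unfolding gen_set_def by blast
qed

section \<open>The ideal property\<close>

lemma semigroup_ideal_gen_set:
  assumes "a \<in> Iisg G"
  shows "semigroup_ideal (Iisg G) pcomp (gen_set G a)"
  unfolding semigroup_ideal_def
proof (intro conjI ballI)
  show "gen_set G a \<subseteq> Iisg G"
    by (auto simp: gen_set_def)
next
  fix s x assume s: "s \<in> Iisg G" and "x \<in> gen_set G a"
  then have x: "x \<in> Iisg G" "embeds_in G (dom (vmap a)) (dom (vmap x))"
    by (simp_all add: gen_set_iff[OF assms])
  have "dom (vmap (pcomp s x)) \<subseteq> dom (vmap x)"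
    by (auto simp: pcomp_def map_comp_Some_iff)
  then show "pcomp s x \<in> gen_set G a"
    using x s embeds_in_subset by (simp add: gen_set_iff[OF assms] pcomp_in_Iisg)
next
  fix x s assume s: "s \<in> Iisg G" and "x \<in> gen_set G a"
  then have x: "x \<in> Iisg G" "embeds_in G (dom (vmap a)) (dom (vmap x))"
    by (simp_all add: gen_set_iff[OF assms])
  \<comment> \<open>The domain of this product lies in that of \<open>s\<close>, not necessarily in
    that of \<open>x\<close>. The argument therefore starts from its range, which lies in the range
    of \<open>x\<close>, and returns to the domain along the product itself.\<close>
  let ?R = "ran (vmap (pcomp x s))"
  have "induced_iso G (ran (vmap x)) (dom (vmap x)) (partial_map_inverse x)"
    by (rule induced_iso_inverse[OF Iisg_induced_iso[OF x(1)]])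
  then have "embeds_in G (dom (vmap a)) (ran (vmap x))"
    using x(2) by (rule embeds_in_induced_iso)
  moreover have "?R \<subseteq> ran (vmap x)"
    by (auto simp: pcomp_def map_comp_Some_iff ran_def)
  ultimately have "embeds_in G (dom (vmap a)) ?R"
    by (rule embeds_in_subset)
  moreover have px: "pcomp x s \<in> Iisg G"
    using x(1) s by (rule pcomp_in_Iisg)
  ultimately show "pcomp x s \<in> gen_set G a"
    using embeds_in_induced_iso[OF Iisg_induced_iso[OF px]] by (simp add: gen_set_iff[OF assms])
qed

section \<open>Minimality\<close>

lemma map_factor_through:
  assumes "inj_on \<beta> (dom \<beta>)" "inj_on a (dom a)" "dom \<beta> = dom \<phi>" "ran \<beta> \<subseteq> dom a"
  shows "(\<phi> \<circ>\<^sub>m (map_inverse \<beta> \<circ>\<^sub>m map_inverse a)) \<circ>\<^sub>m (a \<circ>\<^sub>m \<beta>) = \<phi>"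
proof
  show "((\<phi> \<circ>\<^sub>m (map_inverse \<beta> \<circ>\<^sub>m map_inverse a)) \<circ>\<^sub>m (a \<circ>\<^sub>m \<beta>)) x = \<phi> x" for x
  proof (cases "\<phi> x")
    case None
    \<comment> \<open>Equal domains of \<open>\<beta>\<close> and \<open>\<phi>\<close> make both
      sides undefined at the same points.\<close>
    then have "\<beta> x = None"
      using assms(3) by (metis domIff)
    then show ?thesis
      using None by (simp add: map_comp_def)
  next
    case (Some z)
    then obtain y where y: "\<beta> x = Some y"
      using assms(3) by blast
    then obtain w where w: "a y = Some w"
      using assms(4) by (meson domD ranI subsetD)
    \<comment> \<open>The inverses run the chain from \<open>x\<close> through \<open>y\<close> to
      \<open>w\<close> backwards, so \<open>\<phi>\<close> is finally applied to
      \<open>x\<close>.\<close>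
    have "map_inverse \<beta> y = Some x" "map_inverse a w = Some y"
      using y w assms by (simp_all add: map_inverse_eq_Some_iff)
    then show ?thesis
      using y w by simp
  qed
qed

lemma gen_set_subset_ideal:
  assumes a: "a \<in> Iisg G" and ideal: "semigroup_ideal (Iisg G) pcomp I" "a \<in> I"
  shows "gen_set G a \<subseteq> I"
proof
  fix \<phi> assume "\<phi> \<in> gen_set G a"
  then have \<phi>: "\<phi> \<in> Iisg G" "embeds_in G (dom (vmap a)) (dom (vmap \<phi>))"
    by (simp_all add: gen_set_iff[OF a])
  then obtain L \<beta> where L: "L \<subseteq> dom (vmap a)" and \<beta>: "induced_iso G (dom (vmap \<phi>)) L \<beta>"
    by (auto simp: embeds_in_def)
  have "dom (vmap \<phi>) \<subseteq> verts G" "L \<subseteq> verts G"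
    using \<phi>(1) a L by (auto simp: Iisg_iff)
  \<comment> \<open>The embedding is itself an element of \<open>Iisg G\<close>, hence an admissible
    multiplier.\<close>
  then have \<beta>_in: "\<beta> \<in> Iisg G"
    using \<beta> by (simp add: Iisg_iff induced_iso_domD[OF \<beta>])
  \<comment> \<open>\<open>\<gamma>\<close> undoes \<open>pcomp a \<beta>\<close> and then applies
    \<open>\<phi>\<close>. The ideal absorbs \<open>\<beta>\<close> on the right of \<open>a\<close>
    and then \<open>\<gamma>\<close> on the left.\<close>
  define \<gamma> where "\<gamma> = pcomp \<phi> (pcomp (partial_map_inverse \<beta>) (partial_map_inverse a))"
  have "\<gamma> \<in> Iisg G"
    unfolding \<gamma>_def using \<phi>(1) \<beta>_in a by (intro pcomp_in_Iisg partial_map_inverse_in_Iisg)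
  then have "pcomp \<gamma> (pcomp a \<beta>) \<in> I"
    using ideal \<beta>_in unfolding semigroup_ideal_def by blast
  moreover have "pcomp \<gamma> (pcomp a \<beta>) = \<phi>"
  proof -
    have edges: "dom (emap \<psi>) = induced_edges G (dom (vmap \<psi>))"
      and inj: "inj_on (vmap \<psi>) (dom (vmap \<psi>))" "inj_on (emap \<psi>) (dom (emap \<psi>))"
      if "\<psi> \<in> Iisg G" for \<psi>
      using Iisg_induced_iso[OF that] unfolding induced_iso_iff by blast+
    have v: "dom (vmap \<beta>) = dom (vmap \<phi>)" "ran (vmap \<beta>) \<subseteq> dom (vmap a)"
      and "ran (emap \<beta>) = induced_edges G L"
      using \<beta> L by (simp_all add: induced_iso_iff)
    \<comment> \<open>All graphs involved are induced, so the relations between vertex sets carry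
      over to edge sets, and the factorization applies to both components.\<close>
    then have e: "dom (emap \<beta>) = dom (emap \<phi>)" "ran (emap \<beta>) \<subseteq> dom (emap a)"
      using edges \<beta>_in \<phi>(1) a L by auto
    show ?thesis
      unfolding \<gamma>_def pcomp_def partial_map_inverse_def
      using map_factor_through[OF inj(1)[OF \<beta>_in] inj(1)[OF a] v]
        map_factor_through[OF inj(2)[OF \<beta>_in] inj(2)[OF a] e] by simp
  qed
  ultimately show "\<phi> \<in> I"
    by simp
qed

theorem theorem4p17:
  fixes G :: "('v, 'e) multigraph" and a :: "('v, 'e) partial_map"
  assumes "finite_multigraph G"
    and "a \<in> Iisg G"
  shows "semigroup_ideal (Iisg G) pcomp (gen_set G a) \<and>
    a \<in> gen_set G a \<and>
    (\<forall>I. semigroup_ideal (Iisg G) pcomp I \<and> a \<in> I \<longrightarrow> gen_set G a \<subseteq> I)"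
proof -
  \<comment> \<open>The domain of \<open>a\<close> embeds in itself by the identity.\<close>
  have "embeds_in G (dom (vmap a)) (dom (vmap a))"
    unfolding embeds_in_def using induced_iso_restrict_id by blast
  then have "a \<in> gen_set G a"
    using assms(2) by (simp add: gen_set_iff)
  then show ?thesis
    using assms(2) semigroup_ideal_gen_set gen_set_subset_ideal by blast
qed

end
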